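(* Let $\mathcal{X},\mathcal{Y}$ be Banach spaces, $m\ge1$, $\mathcal{G}\subset\mathbb{R}^m$ non-empty, and let $\mathrm{R}_{\mathcal{G}}$ be a non-empty set of sequences in $\mathcal{G}$ such that every subsequence of a sequence in $\mathrm{R}_{\mathcal{G}}$ also belongs to $\mathrm{R}_{\mathcal{G}}$. Let $K:\mathbb{R}^m\times\mathbb{R}^m\to\mathcal{L}(\mathcal{X};\mathcal{Y})$ satisfy property (SC), be compactly $\mathrm{R}_{\mathcal{G}}$-multi-Bi-almost automorphic, and be $\lambda$-bounded with $\lambda(\mathbf{t},\mathbf{s})=\phi(\mathbf{t}-\mathbf{s})$ and $\phi\in L^1(\mathbb{R}^m)$. Then the operator $\Gamma$ defined by $$\Gamma u(\mathbf{t}):=\int_{\mathbb{R}^m}K(\mathbf{t},\eta)u(\eta)\,d\eta$$ maps the Banach space $\mathcal{K}\mathrm{R}_{\mathcal{G}}AA(\mathbb{R}^m;\mathcal{X})\cap BC(\mathbb{R}^m;\mathcal{X})$ to the Banach space $\mathcal{K}\mathrm{R}_{\mathcal{G}}AA(\mathbb{R}^m;\mathcal{Y})\cap BC(\mathbb{R}^m;\mathcal{Y})$.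
   Context: $\mathcal{L}(\mathcal{X};\mathcal{Y})$ is the space of bounded linear operators with the operator norm. $BC(\mathbb{R}^m;\mathcal{X})$ is the space of bounded continuous functions; the spaces in the claim carry the supremum norm. A continuous $f:\mathbb{R}^m\to\mathcal{X}$ is compactly $\mathrm{R}_{\mathcal{G}}$-multi-almost automorphic (written $f\in\mathcal{K}\mathrm{R}_{\mathcal{G}}AA(\mathbb{R}^m;\mathcal{X})$) if for every sequence $(\mathbf{b}_k)\in\mathrm{R}_{\mathcal{G}}$ there exist a subsequence $(\mathbf{b}_{k_l})$ and a function $f^*:\mathbb{R}^m\to\mathcal{X}$ such that $f(\mathbf{t}+\mathbf{b}_{k_l})\to f^*(\mathbf{t})$ and $f^*(\mathbf{t}-\mathbf{b}_{k_l})\to f(\mathbf{t})$ as $l\to\infty$, uniformly for $\mathbf{t}$ in compact subsets of $\mathbb{R}^m$. Property (SC): for each $x\in\mathcal{X}$ the function $(\mathbf{t},\mathbf{s})\mapsto K(\mathbf{t},\mathbf{s})x$ is continuous. $K$ is compactly $\mathrm{R}_{\mathcal{G}}$-multi-Bi-almost automorphic if for every sequence $(\mathbf{b}_k)\in\mathrm{R}_{\mathcal{G}}$ there exist a subsequence $(\mathbf{b}_{k_l})$ and $K^*:\mathbb{R}^m\times\mathbb{R}^m\to\mathcal{L}(\mathcal{X};\mathcal{Y})$ such that $K(\mathbf{t}+\mathbf{b}_{k_l},\mathbf{s}+\mathbf{b}_{k_l})\to K^*(\mathbf{t},\mathbf{s})$ and $K^*(\mathbf{t}-\mathbf{b}_{k_l},\mathbf{s}-\mathbf{b}_{k_l})\to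 K(\mathbf{t},\mathbf{s})$ as $l\to\infty$, in operator norm, uniformly for $(\mathbf{t},\mathbf{s})$ in compact subsets of $\mathbb{R}^m\times\mathbb{R}^m$. $K$ is $\lambda$-bounded if there is a non-negative function $\lambda:\mathbb{R}^m\times\mathbb{R}^m\to\mathbb{R}$ with $\|K(\mathbf{t}+\tau,\mathbf{s}+\tau)\|_{\mathcal{L}(\mathcal{X};\mathcal{Y})}\le\lambda(\mathbf{t},\mathbf{s})$ for all $\mathbf{t},\mathbf{s},\tau\in\mathbb{R}^m$. *)

theory Defs
  imports "HOL-Analysis.Analysis"
begin

text \<open>
  The library defines \<^const>\<open>has_bochner_integral\<close> only for second countable (hence separable)
  target spaces. The following is the same definition for arbitrary normed spaces. Existence of the
  approximating simple functions makes \<open>f\<close> almost everywhere separably valued, so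
  that over a complete measure such as \<^const>\<open>lebesgue\<close> this is the usual Bochner
  integrability of strongly measurable functions.
\<close>

inductive has_Bochner_integral ::
    "'a measure \<Rightarrow> ('a \<Rightarrow> 'b::real_normed_vector) \<Rightarrow> 'b \<Rightarrow> bool" for M f x where
  "f \<in> borel_measurable M \<Longrightarrow>
    (\<And>i. Bochner_Integration.simple_bochner_integrable M (s i)) \<Longrightarrow>
    (\<lambda>i. \<integral>\<^sup>+y. norm (f y - s i y) \<partial>M) \<longlonglongrightarrow> 0 \<Longrightarrow>
    (\<lambda>i. Bochner_Integration.simple_bochner_integral M (s i)) \<longlonglongrightarrow> x \<Longrightarrow>
    has_Bochner_integral M f x"

definition Bochner_integrable ::
    "'a measure \<Rightarrow> ('a \<Rightarrow> 'b::real_normed_vector) \<Rightarrow> bool" where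
  "Bochner_integrable M f \<longleftrightarrow> (\<exists>x. has_Bochner_integral M f x)"

definition Bochner_integral ::
    "'a measure \<Rightarrow> ('a \<Rightarrow> 'b::real_normed_vector) \<Rightarrow> 'b" where
  "Bochner_integral M f =
    (if Bochner_integrable M f then THE x. has_Bochner_integral M f x else 0)"

lemma has_Bochner_integral_iff_library:
  fixes f :: "'a \<Rightarrow> 'b::{real_normed_vector, second_countable_topology}"
  shows "has_Bochner_integral M f x \<longleftrightarrow> has_bochner_integral M f x"
  by (simp add: has_Bochner_integral.simps has_bochner_integral.simps)

lemma borel_measurable_norm_diff_simple:
  fixes f s :: "'a \<Rightarrow> 'b::real_normed_vector"
  assumes f: "f \<in> borel_measurable M" and s: "simple_function M s"
  shows "(\<lambda>x. norm (f x - s x)) \<in> borel_measurable M"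
proof (rule measurable_compose_countable'[where I = "s ` space M" and g = s
        and f = "\<lambda>i x. norm (f x - i)"])
  show "(\<lambda>x. norm (f x - i)) \<in> borel_measurable M" for i
    by (rule measurable_compose[OF f])
       (intro borel_measurable_continuous_onI continuous_intros)
  show "s \<in> measurable M (count_space (s ` space M))"
    using s by (auto simp: simple_function_def intro!: measurable_count_space_eq2[THEN iffD2])
  show "countable (s ` space M)"
    using s by (auto simp: simple_function_def intro: countable_finite)
qed

lemma has_Bochner_integral_unique:
  assumes "has_Bochner_integral M f x" and "has_Bochner_integral M f y"
  shows "x = y"
proof -
  obtain s where f: "f \<in> borel_measurable M"
    and s: "\<And>i. Bochner_Integration.simple_bochner_integrable M (s i)"
    and s0: "(\<lambda>i. \<integral>\<^sup>+z. norm (f z - s i z) \<partial>M) \<longlonglongrightarrow> 0"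
    and sx: "(\<lambda>i. Bochner_Integration.simple_bochner_integral M (s i)) \<longlonglongrightarrow> x"
    using assms(1) by cases (rule that)
  obtain t where "f \<in> borel_measurable M"
    and t: "\<And>i. Bochner_Integration.simple_bochner_integrable M (t i)"
    and t0: "(\<lambda>i. \<integral>\<^sup>+z. norm (f z - t i z) \<partial>M) \<longlonglongrightarrow> 0"
    and ty: "(\<lambda>i. Bochner_Integration.simple_bochner_integral M (t i)) \<longlonglongrightarrow> y"
    using assms(2) by cases (rule that)
  have sf: "simple_function M (s i)" "simple_function M (t i)" for i
    using s[of i] t[of i] by (auto elim: simple_bochner_integrable.cases)
  have bound: "ennreal (norm (Bochner_Integration.simple_bochner_integral M (s i) - Bochner_Integration.simple_bochner_integral M (t i)))
      \<le> (\<integral>\<^sup>+z. norm (f z - s i z) \<partial>M) + (\<integral>\<^sup>+z. norm (f z - t i z) \<partial>M)" for i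
  proof -
    have st: "Bochner_Integration.simple_bochner_integrable M (\<lambda>z. s i z - t i z)"
      by (rule simple_bochner_integrable_compose2[OF _ s t]) simp
    have nst: "Bochner_Integration.simple_bochner_integrable M (\<lambda>z. norm (s i z - t i z))"
      by (rule simple_bochner_integrable_compose2[OF _ s t, where p = "\<lambda>a b. norm (a - b)"]) simp
    have "norm (Bochner_Integration.simple_bochner_integral M (s i) - Bochner_Integration.simple_bochner_integral M (t i))
        \<le> Bochner_Integration.simple_bochner_integral M (\<lambda>z. norm (s i z - t i z))"
      using simple_bochner_integral_norm_bound[OF st] simple_bochner_integral_diff[OF s t]
      by simp
    then have "ennreal (norm (Bochner_Integration.simple_bochner_integral M (s i) - Bochner_Integration.simple_bochner_integral M (t i)))
        \<le> (\<integral>\<^sup>+z. norm (s i z - t i z) \<partial>M)"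
      using simple_bochner_integral_eq_nn_integral[OF nst] by (simp add: ennreal_leI flip: simple_bochner_integral_eq_nn_integral[OF nst])
    also have "\<dots> \<le> (\<integral>\<^sup>+z. ennreal (norm (f z - s i z)) + ennreal (norm (f z - t i z)) \<partial>M)"
    proof (rule nn_integral_mono)
      fix z
      have "norm (s i z - t i z) \<le> norm (f z - s i z) + norm (f z - t i z)"
        using norm_triangle_ineq4[of "f z - t i z" "f z - s i z"] by simp
      then show "ennreal (norm (s i z - t i z)) \<le> ennreal (norm (f z - s i z)) + ennreal (norm (f z - t i z))"
        by (simp flip: ennreal_plus)
    qed
    also have "\<dots> = (\<integral>\<^sup>+z. norm (f z - s i z) \<partial>M) + (\<integral>\<^sup>+z. norm (f z - t i z) \<partial>M)"
      using borel_measurable_norm_diff_simple[OF f sf(1)]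
        borel_measurable_norm_diff_simple[OF f sf(2)]
      by (intro nn_integral_add) auto
    finally show ?thesis .
  qed
  have "(\<lambda>i. (\<integral>\<^sup>+z. norm (f z - s i z) \<partial>M) + (\<integral>\<^sup>+z. norm (f z - t i z) \<partial>M)) \<longlonglongrightarrow> 0 + 0"
    by (intro tendsto_add s0 t0)
  then have *: "(\<lambda>i. (\<integral>\<^sup>+z. norm (f z - s i z) \<partial>M) + (\<integral>\<^sup>+z. norm (f z - t i z) \<partial>M)) \<longlonglongrightarrow> 0"
    by (simp only: add_0_left)
  have "(\<lambda>i. ennreal (norm (Bochner_Integration.simple_bochner_integral M (s i)
      - Bochner_Integration.simple_bochner_integral M (t i)))) \<longlonglongrightarrow> 0"
    by (rule tendsto_sandwich[OF _ _ tendsto_const *]; rule always_eventually; intro allI)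
       (rule zero_le bound)+
  then have "(\<lambda>i. norm (Bochner_Integration.simple_bochner_integral M (s i)
      - Bochner_Integration.simple_bochner_integral M (t i))) \<longlonglongrightarrow> 0"
    by (subst (asm) ennreal_0[symmetric], subst (asm) tendsto_ennreal_iff) simp_all
  moreover have "(\<lambda>i. norm (Bochner_Integration.simple_bochner_integral M (s i)
      - Bochner_Integration.simple_bochner_integral M (t i))) \<longlonglongrightarrow> norm (x - y)"
    by (rule tendsto_norm[OF tendsto_diff[OF sx ty]])
  ultimately have "0 = norm (x - y)"
    by (rule LIMSEQ_unique)
  then show "x = y"
    by simp
qed

text \<open>A sequence is a function \<open>b\<close> on \<^typ>\<open>nat\<close>; its subsequences are the \<open>b \<circ> r\<close> with \<open>r\<close>
  strictly increasing.\<close>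

definition compactly_AA ::
    "(nat \<Rightarrow> 'a::euclidean_space) set \<Rightarrow> ('a \<Rightarrow> 'b::real_normed_vector) set" where
  "compactly_AA R = {f. continuous_on UNIV f \<and>
    (\<forall>b\<in>R. \<exists>r fs. strict_mono (r :: nat \<Rightarrow> nat) \<and>
      (\<forall>C. compact C \<longrightarrow>
        uniform_limit C (\<lambda>l t. f (t + b (r l))) fs sequentially \<and>
        uniform_limit C (\<lambda>l t. fs (t - b (r l))) f sequentially))}"

text \<open>As elements of the library's space of bounded continuous functions, so that the norm is the
  supremum norm.\<close>

definition compactly_AA_BC ::
    "(nat \<Rightarrow> 'a::euclidean_space) set \<Rightarrow> ('a \<Rightarrow>\<^sub>C 'b::real_normed_vector) set" where
  "compactly_AA_BC R = {u. apply_bcontfun u \<in> compactly_AA R}"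

definition property_SC ::
    "('a::euclidean_space \<Rightarrow> 'a \<Rightarrow> ('x::real_normed_vector \<Rightarrow>\<^sub>L 'y::real_normed_vector)) \<Rightarrow> bool" where
  "property_SC K \<longleftrightarrow> (\<forall>x. continuous_on UNIV (\<lambda>(t, s). blinfun_apply (K t s) x))"

definition compactly_bi_AA ::
    "(nat \<Rightarrow> 'a::euclidean_space) set \<Rightarrow>
      ('a \<Rightarrow> 'a \<Rightarrow> ('x::real_normed_vector \<Rightarrow>\<^sub>L 'y::real_normed_vector)) \<Rightarrow> bool" where
  "compactly_bi_AA R K \<longleftrightarrow>
    (\<forall>b\<in>R. \<exists>r Ks. strict_mono (r :: nat \<Rightarrow> nat) \<and>
      (\<forall>C. compact C \<longrightarrow>
        uniform_limit C (\<lambda>l (t, s). K (t + b (r l)) (s + b (r l))) (\<lambda>(t, s). Ks t s) sequentially \<and>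
        uniform_limit C (\<lambda>l (t, s). Ks (t - b (r l)) (s - b (r l))) (\<lambda>(t, s). K t s) sequentially))"

definition lambda_bounded ::
    "('a::euclidean_space \<Rightarrow> 'a \<Rightarrow> real) \<Rightarrow>
      ('a \<Rightarrow> 'a \<Rightarrow> ('x::real_normed_vector \<Rightarrow>\<^sub>L 'y::real_normed_vector)) \<Rightarrow> bool" where
  "lambda_bounded lam K \<longleftrightarrow>
    (\<forall>t s. 0 \<le> lam t s) \<and> (\<forall>t s \<tau>. norm (K (t + \<tau>) (s + \<tau>)) \<le> lam t s)"

definition Gamma_op ::
    "('a::euclidean_space \<Rightarrow> 'a \<Rightarrow> ('x::real_normed_vector \<Rightarrow>\<^sub>L 'y::real_normed_vector)) \<Rightarrow>
      ('a \<Rightarrow> 'x) \<Rightarrow> 'a \<Rightarrow> 'y" where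
  "Gamma_op K u t = Bochner_integral lebesgue (\<lambda>\<eta>. blinfun_apply (K t \<eta>) (u \<eta>))"

end

theory Submission
  imports Defs "HOL-Library.Diagonal_Subsequence"
begin

text \<open>
  Write \<open>F (t, s) = K t s (u s)\<close>, so that \<open>\<Gamma> u t\<close> is the integral of \<open>F (t, s)\<close> over \<open>s\<close>. The
  argument separates a statement about the function \<open>F\<close> on the product space from one about integration.

  For \<open>F\<close>: the kernel is only strongly continuous, and its bound \<open>\<phi> (t - s)\<close> may be locally unbounded.
  The uniform boundedness principle nevertheless bounds the operator norms on compact sets. Hence \<open>F\<close> is
  continuous, and if \<open>K\<close> and \<open>u\<close> are almost automorphic along a common sequence with limits \<open>L\<close> and
  \<open>w\<close>, then \<open>F\<close> is so along the corresponding diagonal sequence of the product space, with limit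
  \<open>(t, s) \<mapsto> L t s (w s)\<close> (\<open>strongly_continuous_apply\<close>, \<open>AA_along_apply\<close>).

  For the integral: \<open>F\<close> is dominated by \<open>h (t - s)\<close> with \<open>h = \<phi> * norm u\<close> integrable. This bound is
  invariant under diagonal translations, and by translation invariance of Lebesgue measure translating
  \<open>t\<close> in the integral amounts to translating \<open>F\<close> diagonally. A dominated convergence theorem
  that is uniform for \<open>t\<close> in compact sets (\<open>compactly_convergent_Bochner_integral\<close>) then transfers compact
  convergence from the translates of \<open>F\<close> to those of \<open>\<Gamma> u\<close>. Applied to the given sequence it yields
  the limit function, applied to the limit with opposite shifts it yields the return to \<open>\<Gamma> u\<close>, and
  applied to shifts tending to zero it yields the continuity of \<open>\<Gamma> u\<close>.

  The integrals exist although the target may be non-separable, because the integrands are continuous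
  with an integrable bound (\<open>Bochner_integrable_continuous\<close>). That the function spaces are vector spaces
  follows by passing to common subsequences, and their completeness by a diagonal sequence
  (\<open>complete_compactly_AA_BC\<close>).
\<close>

section \<open>Bochner integration of continuous functions\<close>

text \<open>
  The case \<open>c = 1\<close> gives translations and \<open>c = -1\<close> the reflection \<open>s \<mapsto> a - s\<close>, which turns a bound
  by \<open>h (t - s)\<close> into one by \<open>h\<close> itself.
\<close>

lemma distr_lebesgue_isometry:
  fixes a :: "'a::euclidean_space"
  assumes "\<bar>c\<bar> = 1"
  shows "distr lebesgue lebesgue (\<lambda>x. a + c *\<^sub>R x) = lebesgue"
    and "(\<lambda>x. a + c *\<^sub>R x) \<in> lebesgue \<rightarrow>\<^sub>M lebesgue"
proof -
  have T: "(\<lambda>x. a + (\<Sum>j\<in>Basis. (c * (x \<bullet> j)) *\<^sub>R j)) = (\<lambda>x. a + c *\<^sub>R x)"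
    by (simp add: euclidean_representation flip: scaleR_scaleR scaleR_sum_right)
  have c: "c \<noteq> 0" using assms by auto
  show "distr lebesgue lebesgue (\<lambda>x. a + c *\<^sub>R x) = lebesgue"
    using lebesgue_affine_euclidean[of "\<lambda>_. c" a] c assms
    unfolding T by (simp add: density_1)
  show "(\<lambda>x. a + c *\<^sub>R x) \<in> lebesgue \<rightarrow>\<^sub>M lebesgue"
    using lebesgue_affine_measurable[of "\<lambda>_. c" a] c unfolding T by simp
qed

text \<open>
  Composition with \<open>T\<close> carries approximating simple functions to approximating simple functions.
  Surjectivity makes both have the same set of values, so that the two simple integrals are literally
  the same finite sum.
\<close>

lemma has_Bochner_integral_measure_preserving:
  assumes f: "has_Bochner_integral M f x"
    and T: "T \<in> M \<rightarrow>\<^sub>M M" and M: "distr M M T = M" and surj: "T ` space M = space M"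
  shows "has_Bochner_integral M (\<lambda>z. f (T z)) x"
  using f
proof cases
  case (1 s)
  have sf: "simple_function M (s i)" and fin: "emeasure M {y \<in> space M. s i y \<noteq> 0} \<noteq> \<infinity>" for i
    using 1(2)[of i] by (auto elim: simple_bochner_integrable.cases)
  have sfT: "simple_function M (\<lambda>z. s i (T z))" for i
    using simple_function_comp[OF T sf] by (simp add: comp_def)
  have meas: "{y \<in> space M. s i y \<in> A} \<in> sets M" for i A
    using simple_functionD(2)[OF sf, of i A] by (simp add: vimage_def Int_def conj_commute)
  have em: "emeasure M {y \<in> space M. s i (T y) \<in> A} = emeasure M {y \<in> space M. s i y \<in> A}" for i A
  proof -
    have "emeasure M {y \<in> space M. s i y \<in> A} = emeasure (distr M M T) {y \<in> space M. s i y \<in> A}"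
      by (simp add: M)
    also have "\<dots> = emeasure M (T -` {y \<in> space M. s i y \<in> A} \<inter> space M)"
      by (rule emeasure_distr[OF T meas])
    also have "T -` {y \<in> space M. s i y \<in> A} \<inter> space M = {y \<in> space M. s i (T y) \<in> A}"
      using T by (auto dest: measurable_space)
    finally show ?thesis by simp
  qed
  show ?thesis
  proof
    show "(\<lambda>z. f (T z)) \<in> borel_measurable M"
      using 1(1) T by (rule measurable_compose_rev)
    show "Bochner_Integration.simple_bochner_integrable M (\<lambda>z. s i (T z))" for i
      using sfT fin[of i] em[of i "-{0}"] by (intro simple_bochner_integrable.intros) auto
    have "(\<integral>\<^sup>+y. norm (f (T y) - s i (T y)) \<partial>M) = (\<integral>\<^sup>+y. norm (f y - s i y) \<partial>M)" for i
    proof -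
      have "(\<integral>\<^sup>+y. norm (f y - s i y) \<partial>M) = (\<integral>\<^sup>+y. norm (f y - s i y) \<partial>distr M M T)"
        by (simp add: M)
      also have "\<dots> = (\<integral>\<^sup>+y. norm (f (T y) - s i (T y)) \<partial>M)"
        using borel_measurable_norm_diff_simple[OF 1(1) sf[of i]]
        by (intro nn_integral_distr T) auto
      finally show ?thesis by simp
    qed
    then show "(\<lambda>i. \<integral>\<^sup>+y. norm (f (T y) - s i (T y)) \<partial>M) \<longlonglongrightarrow> 0"
      using 1(3) by simp
    have "(\<lambda>z. s i (T z)) ` space M = s i ` space M" for i
      using surj by (metis image_image)
    moreover have "measure M {y \<in> space M. s i (T y) = a} = measure M {y \<in> space M. s i y = a}" for i a
      using em[of i "{a}"] by (simp add: measure_def)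
    ultimately have "Bochner_Integration.simple_bochner_integral M (\<lambda>z. s i (T z))
        = Bochner_Integration.simple_bochner_integral M (s i)" for i
      by (simp add: simple_bochner_integral_def)
    then show "(\<lambda>i. Bochner_Integration.simple_bochner_integral M (\<lambda>z. s i (T z))) \<longlonglongrightarrow> x"
      using 1(4) by simp
  qed
qed

lemma simple_bochner_integral_dist_le:
  assumes s: "Bochner_Integration.simple_bochner_integrable M s"
    and t: "Bochner_Integration.simple_bochner_integrable M t"
  shows "ennreal (norm (Bochner_Integration.simple_bochner_integral M s - Bochner_Integration.simple_bochner_integral M t))
      \<le> (\<integral>\<^sup>+z. norm (s z - t z) \<partial>M)"
proof -
  have st: "Bochner_Integration.simple_bochner_integrable M (\<lambda>z. s z - t z)"
    by (rule simple_bochner_integrable_compose2[OF _ s t]) simp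
  have nst: "Bochner_Integration.simple_bochner_integrable M (\<lambda>z. norm (s z - t z))"
    by (rule simple_bochner_integrable_compose2[OF _ s t, where p = "\<lambda>a b. norm (a - b)"]) simp
  have "norm (Bochner_Integration.simple_bochner_integral M s - Bochner_Integration.simple_bochner_integral M t)
      \<le> Bochner_Integration.simple_bochner_integral M (\<lambda>z. norm (s z - t z))"
    using simple_bochner_integral_norm_bound[OF st] simple_bochner_integral_diff[OF s t] by simp
  then show ?thesis
    by (simp add: ennreal_leI flip: simple_bochner_integral_eq_nn_integral[OF nst])
qed

text \<open>
  This estimate serves in place of linearity and the triangle inequality for the integral. Measurability
  of the norm of the difference is an assumption, because a difference of Borel functions into a
  non-separable space need not be Borel and \<open>M\<close> need not be complete.
\<close>

lemma has_Bochner_integral_dist_le: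
  fixes f g :: "'a \<Rightarrow> 'b::real_normed_vector"
  assumes f: "has_Bochner_integral M f x" and g: "has_Bochner_integral M g y"
    and fg: "(\<lambda>z. norm (f z - g z)) \<in> borel_measurable M"
  shows "ennreal (norm (x - y)) \<le> (\<integral>\<^sup>+z. norm (f z - g z) \<partial>M)"
proof -
  obtain s where fm: "f \<in> borel_measurable M"
    and s: "\<And>i. Bochner_Integration.simple_bochner_integrable M (s i)"
    and s0: "(\<lambda>i. \<integral>\<^sup>+z. norm (f z - s i z) \<partial>M) \<longlonglongrightarrow> 0"
    and sx: "(\<lambda>i. Bochner_Integration.simple_bochner_integral M (s i)) \<longlonglongrightarrow> x"
    using f by cases (rule that)
  obtain t where gm: "g \<in> borel_measurable M"
    and t: "\<And>i. Bochner_Integration.simple_bochner_integrable M (t i)"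
    and t0: "(\<lambda>i. \<integral>\<^sup>+z. norm (g z - t i z) \<partial>M) \<longlonglongrightarrow> 0"
    and ty: "(\<lambda>i. Bochner_Integration.simple_bochner_integral M (t i)) \<longlonglongrightarrow> y"
    using g by cases (rule that)
  have sf: "simple_function M (s i)" "simple_function M (t i)" for i
    using s[of i] t[of i] by (auto elim: simple_bochner_integrable.cases)
  have "ennreal (norm (Bochner_Integration.simple_bochner_integral M (s i) - Bochner_Integration.simple_bochner_integral M (t i)))
      \<le> (\<integral>\<^sup>+z. norm (f z - g z) \<partial>M) + ((\<integral>\<^sup>+z. norm (f z - s i z) \<partial>M) + (\<integral>\<^sup>+z. norm (g z - t i z) \<partial>M))"
    (is "?l i \<le> ?r i") for i
  proof -
    have "?l i \<le> (\<integral>\<^sup>+z. norm (s i z - t i z) \<partial>M)"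
      by (rule simple_bochner_integral_dist_le[OF s t])
    also have "\<dots> \<le> (\<integral>\<^sup>+z. ennreal (norm (f z - g z)) + (ennreal (norm (f z - s i z)) + ennreal (norm (g z - t i z))) \<partial>M)"
    proof (rule nn_integral_mono)
      fix z
      have "norm (s i z - t i z) \<le> norm (f z - g z) + (norm (f z - s i z) + norm (g z - t i z))"
        by norm
      then show "ennreal (norm (s i z - t i z)) \<le> ennreal (norm (f z - g z)) + (ennreal (norm (f z - s i z)) + ennreal (norm (g z - t i z)))"
        by (simp flip: ennreal_plus)
    qed
    also have "\<dots> = ?r i"
      using borel_measurable_norm_diff_simple[OF fm sf(1)]
        borel_measurable_norm_diff_simple[OF gm sf(2)] fg
      by (subst nn_integral_add) (auto simp: nn_integral_add)
    finally show ?thesis .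
  qed
  moreover have "?l \<longlonglongrightarrow> ennreal (norm (x - y))"
    by (intro tendsto_ennrealI tendsto_norm tendsto_diff sx ty)
  moreover have "?r \<longlonglongrightarrow> (\<integral>\<^sup>+z. norm (f z - g z) \<partial>M) + (0 + 0)"
    by (intro tendsto_add tendsto_const s0 t0)
  ultimately show ?thesis
    by (metis (no_types, lifting) LIMSEQ_le add.right_neutral)
qed

text \<open>
  Smallness of the mass of \<open>h\<close> far from the origin reduces every estimate below to one on a
  compact set.
\<close>

lemma nn_integral_tail_tendsto_0:
  fixes h :: "'a::euclidean_space \<Rightarrow> real" and a :: 'a
  assumes h: "integrable lebesgue h" and nn: "\<And>x. 0 \<le> h x"
  shows "(\<lambda>n. \<integral>\<^sup>+x. ennreal (h x * indicator (- cball a (real n)) x) \<partial>lebesgue) \<longlonglongrightarrow> 0"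
proof -
  have [measurable]: "cball a (real n) \<in> sets lebesgue" for n by (simp add: lmeasurable_cball fmeasurableD)
  have hm[measurable]: "h \<in> borel_measurable lebesgue" using h by auto
  have "(\<lambda>n. \<integral>\<^sup>+x. ennreal (h x * indicator (- cball a (real n)) x) \<partial>lebesgue) \<longlonglongrightarrow> (\<integral>\<^sup>+x. 0 \<partial>(lebesgue :: 'a measure))"
  proof (rule nn_integral_dominated_convergence[where w = "\<lambda>x. ennreal (h x)"])
    show "(\<integral>\<^sup>+x. ennreal (h x) \<partial>lebesgue) < \<infinity>"
      using h nn by (auto simp: integrable_iff_bounded)
    show "AE x in lebesgue. (\<lambda>n. ennreal (h x * indicator (- cball a (real n)) x)) \<longlonglongrightarrow> 0"
    proof (intro always_eventually allI)
      fix x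
      obtain N where "dist a x \<le> real N" using real_arch_simple by blast
      then have "\<forall>\<^sub>F n in sequentially. ennreal (h x * indicator (- cball a (real n)) x) = 0"
        by (intro eventually_sequentiallyI[of N]) (auto simp: indicator_def)
      then show "(\<lambda>n. ennreal (h x * indicator (- cball a (real n)) x)) \<longlonglongrightarrow> 0"
        by (rule tendsto_eventually)
    qed
    show "AE x in lebesgue. ennreal (h x * indicator (- cball a (real n)) x) \<le> ennreal (h x)" for n
      using nn by (auto simp: indicator_def intro!: always_eventually)
  qed auto
  then show ?thesis by simp
qed

text \<open>
  The approximating function sends \<open>x\<close> to a point of the net that is closer than \<open>e\<close> to \<open>g x\<close>; the
  order in which the net is enumerated decides between several candidates, and nested conditionals keep
  the choice measurable. Where \<open>g x\<close> is far from the net the value is arbitrary.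
\<close>

lemma simple_function_approx_of_net:
  fixes g :: "'a \<Rightarrow> 'b::metric_space"
  assumes "finite A" and g: "g \<in> borel_measurable M"
  shows "\<exists>s. simple_function M s \<and> (\<forall>x. (\<exists>y\<in>A. dist (g x) y < e) \<longrightarrow> dist (g x) (s x) < e)"
  using assms(1)
proof induction
  case empty
  show ?case by (rule exI[of _ "\<lambda>_. undefined"]) simp
next
  case (insert y A)
  then obtain s where s: "simple_function M s"
    "\<And>x. \<exists>y\<in>A. dist (g x) y < e \<Longrightarrow> dist (g x) (s x) < e"
    by blast
  have "{x \<in> space M. dist (g x) y < e} = g -` ball y e \<inter> space M"
    by (auto simp: dist_commute)
  then have "{x \<in> space M. dist (g x) y < e} \<in> sets M"
    using g by (auto intro: measurable_sets)
  then have "simple_function M (\<lambda>x. if dist (g x) y < e then y else s x)"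
    by (intro simple_function_If s) auto
  then show ?case
    using s(2) by (intro exI[of _ "\<lambda>x. if dist (g x) y < e then y else s x"]) auto
qed

lemma borel_measurable_lebesgue_continuous:
  fixes g :: "'a::euclidean_space \<Rightarrow> 'b::topological_space"
  assumes "continuous_on UNIV g"
  shows "g \<in> borel_measurable lebesgue"
  by (intro measurable_completion) (use borel_measurable_continuous_onI[OF assms] in simp)

text \<open>
  The target need not be separable, but a continuous function takes a compact, hence totally bounded, set
  of values on each ball. A finite net of these values gives a simple function that is uniformly close
  to \<open>g\<close> on the ball and zero outside, where \<open>h\<close> controls the error. The integrals of these simple
  functions form a Cauchy sequence, and completeness of the target provides the integral.
\<close>

lemma Bochner_integrable_continuous:
  fixes g :: "'a::euclidean_space \<Rightarrow> 'b::banach"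
  assumes g: "continuous_on UNIV g" and h: "integrable lebesgue h"
    and gh: "\<And>x. norm (g x) \<le> h x"
  shows "Bochner_integrable lebesgue g"
proof -
  have nn: "0 \<le> h x" for x using gh[of x] norm_ge_zero order_trans by blast
  have hm[measurable]: "h \<in> borel_measurable lebesgue" using h by auto
  have gm: "g \<in> borel_measurable lebesgue"
    by (rule borel_measurable_lebesgue_continuous[OF g])
  let ?B = "\<lambda>n. cball (0::'a) (real n)"
  have B[measurable]: "?B n \<in> sets lebesgue" for n by (simp add: lmeasurable_cball fmeasurableD)
  let ?v = "\<lambda>n. measure lebesgue (?B n)"
  have em: "emeasure lebesgue (?B n) = ennreal (?v n)" for n
    by (simp add: emeasure_eq_measure2 lmeasurable_cball fmeasurableD2)
  \<comment> \<open>The tolerance on the ball is divided by its volume, so that the error integrates to at most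
    \<open>1 / (1 + n)\<close> there; for \<open>n = 0\<close> both the volume and \<open>n\<close> vanish, hence the two summands 1.\<close>
  define e where "e n = 1 / ((1 + ?v n) * (1 + real n))" for n
  have e: "0 < e n" for n by (simp add: e_def add_pos_nonneg)
  have ev: "e n * ?v n \<le> 1 / (1 + real n)" for n
  proof -
    have "0 \<le> ?v n" by simp
    moreover have "v / ((1 + v) * k) \<le> 1 / k" if "0 \<le> v" "0 < k" for v k :: real
    proof -
      have "v / (1 + v) * (1 / k) \<le> 1 * (1 / k)"
        using that by (intro mult_right_mono) auto
      then show ?thesis by simp
    qed
    ultimately show ?thesis by (simp only: e_def) simp
  qed
  have "\<exists>s. Bochner_Integration.simple_bochner_integrable lebesgue s \<and>
      (\<forall>x. norm (g x - s x) \<le> e n * indicator (?B n) x + h x * indicator (- ?B n) x)" for n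
  proof -
    have "compact (g ` ?B n)"
      by (intro compact_continuous_image continuous_on_subset[OF g]) auto
    then obtain A where A: "finite A" "g ` ?B n \<subseteq> (\<Union>y\<in>A. ball y (e n))"
      using compact_eq_totally_bounded e by metis
    obtain s where s: "simple_function lebesgue s"
      "\<And>x. \<exists>y\<in>A. dist (g x) y < e n \<Longrightarrow> dist (g x) (s x) < e n"
      using simple_function_approx_of_net[OF A(1) gm] by blast
    define s' where "s' x = (if x \<in> ?B n then s x else 0)" for x
    have "Bochner_Integration.simple_bochner_integrable lebesgue s'"
    proof
      show "simple_function lebesgue s'"
        unfolding s'_def by (intro simple_function_If s(1) simple_function_const) (use B[of n] in simp)
      have "emeasure lebesgue {y \<in> space lebesgue. s' y \<noteq> 0} \<le> emeasure lebesgue (?B n)"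
        by (intro emeasure_mono B) (auto simp: s'_def)
      then show "emeasure lebesgue {y \<in> space lebesgue. s' y \<noteq> 0} \<noteq> \<infinity>"
        unfolding em by (auto simp: top_unique)
    qed
    moreover have "norm (g x - s' x) \<le> e n * indicator (?B n) x + h x * indicator (- ?B n) x" for x
    proof (cases "x \<in> ?B n")
      case True
      then have "\<exists>y\<in>A. dist (g x) y < e n" using A(2) by (fastforce simp: dist_commute)
      from s(2)[OF this] True show ?thesis by (simp add: s'_def dist_norm)
    qed (use gh in \<open>simp add: s'_def\<close>)
    ultimately show ?thesis by blast
  qed
  then obtain s where s: "\<And>n. Bochner_Integration.simple_bochner_integrable lebesgue (s n)"
    and gs: "\<And>n x. norm (g x - s n x) \<le> e n * indicator (?B n) x + h x * indicator (- ?B n) x"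
    by metis
  have sf: "simple_function lebesgue (s n)" for n
    using s[of n] by (auto elim: simple_bochner_integrable.cases)
  let ?d = "\<lambda>n. \<integral>\<^sup>+x. norm (g x - s n x) \<partial>lebesgue"
  let ?t = "\<lambda>n. \<integral>\<^sup>+x. ennreal (h x * indicator (- ?B n) x) \<partial>lebesgue"
  have dn: "?d n \<le> ennreal (1 / (1 + real n)) + ?t n" for n
  proof -
    have "?d n \<le> (\<integral>\<^sup>+x. ennreal (e n) * indicator (?B n) x + ennreal (h x * indicator (- ?B n) x) \<partial>lebesgue)"
    proof (rule nn_integral_mono)
      fix x
      show "ennreal (norm (g x - s n x)) \<le> ennreal (e n) * indicator (?B n) x + ennreal (h x * indicator (- ?B n) x)"
        using gs[of x n] by (cases "x \<in> ?B n") (auto simp: indicator_def ennreal_leI)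
    qed
    also have "\<dots> = (\<integral>\<^sup>+x. ennreal (e n) * indicator (?B n) x \<partial>lebesgue) + ?t n"
      by (rule nn_integral_add) auto
    also have "(\<integral>\<^sup>+x. ennreal (e n) * indicator (?B n) x \<partial>lebesgue) = ennreal (e n * ?v n)"
      using e[of n] by (subst nn_integral_cmult_indicator) (auto simp: em ennreal_mult less_imp_le)
    also have "\<dots> \<le> ennreal (1 / (1 + real n))" by (rule ennreal_leI[OF ev])
    finally show ?thesis by simp
  qed
  have d0: "?d \<longlonglongrightarrow> 0"
  proof (rule tendsto_sandwich[OF _ _ tendsto_const])
    have "(\<lambda>n. 1 / (1 + real n)) \<longlonglongrightarrow> 0"
      using LIMSEQ_inverse_real_of_nat by (simp add: inverse_eq_divide)
    then have "(\<lambda>n. ennreal (1 / (1 + real n))) \<longlonglongrightarrow> ennreal 0"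
      by (rule tendsto_ennrealI)
    from tendsto_add[OF this nn_integral_tail_tendsto_0[OF h nn, of 0]]
    show "(\<lambda>n. ennreal (1 / (1 + real n)) + ?t n) \<longlonglongrightarrow> 0"
      by simp
  qed (use dn in auto)
  let ?I = "\<lambda>n. Bochner_Integration.simple_bochner_integral lebesgue (s n)"
  have dist_I: "ennreal (dist (?I m) (?I n)) \<le> ?d m + ?d n" for m n
  proof -
    have "ennreal (dist (?I m) (?I n)) \<le> (\<integral>\<^sup>+x. norm (s m x - s n x) \<partial>lebesgue)"
      unfolding dist_norm by (rule simple_bochner_integral_dist_le[OF s s])
    also have "\<dots> \<le> (\<integral>\<^sup>+x. ennreal (norm (g x - s m x)) + ennreal (norm (g x - s n x)) \<partial>lebesgue)"
    proof (rule nn_integral_mono)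
      fix x
      have "norm (s m x - s n x) \<le> norm (g x - s m x) + norm (g x - s n x)"
        by norm
      then show "ennreal (norm (s m x - s n x)) \<le> ennreal (norm (g x - s m x)) + ennreal (norm (g x - s n x))"
        by (simp flip: ennreal_plus)
    qed
    also have "\<dots> = ?d m + ?d n"
      using borel_measurable_norm_diff_simple[OF gm sf] by (intro nn_integral_add) auto
    finally show ?thesis .
  qed
  have "Cauchy ?I"
  proof (rule metric_CauchyI)
    fix r :: real assume r: "0 < r"
    have "\<forall>\<^sub>F n in sequentially. ?d n < ennreal (r / 2)"
      using d0 r by (intro order_tendstoD(2)[OF d0]) auto
    then obtain N where N: "\<And>n. n \<ge> N \<Longrightarrow> ?d n < ennreal (r / 2)"
      by (auto simp: eventually_sequentially)
    have "dist (?I m) (?I n) < r" if "m \<ge> N" "n \<ge> N" for m n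
    proof -
      have "ennreal (dist (?I m) (?I n)) < ennreal (r / 2) + ennreal (r / 2)"
        using dist_I add_strict_mono[OF N[OF that(1)] N[OF that(2)]] by (rule le_less_trans)
      also have "\<dots> = ennreal r" using r by (simp flip: ennreal_plus)
      finally show ?thesis using r by (simp add: ennreal_less_iff)
    qed
    then show "\<exists>N. \<forall>m\<ge>N. \<forall>n\<ge>N. dist (?I m) (?I n) < r" by blast
  qed
  then obtain x where "?I \<longlonglongrightarrow> x" using Cauchy_convergent_iff convergent_def by blast
  then have "has_Bochner_integral lebesgue g x"
    by (intro has_Bochner_integral.intros[OF gm s d0])
  then show ?thesis by (auto simp: Bochner_integrable_def)
qed

lemma Bochner_integral_eq:
  assumes "has_Bochner_integral M f x"
  shows "Bochner_integral M f = x"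
proof -
  have "(THE y. has_Bochner_integral M f y) = x"
    using assms by (rule the_equality) (rule has_Bochner_integral_unique[OF _ assms])
  then show ?thesis
    using assms by (auto simp: Bochner_integral_def Bochner_integrable_def)
qed

lemma has_Bochner_integral_Bochner_integral:
  assumes "Bochner_integrable M f"
  shows "has_Bochner_integral M f (Bochner_integral M f)"
proof -
  obtain x where x: "has_Bochner_integral M f x"
    using assms by (auto simp: Bochner_integrable_def)
  then show ?thesis by (simp only: Bochner_integral_eq[OF x])
qed

lemma Bochner_integral_translation:
  fixes f :: "'a::euclidean_space \<Rightarrow> 'b::real_normed_vector"
  assumes "Bochner_integrable lebesgue f"
  shows "Bochner_integral lebesgue (\<lambda>x. f (x + c)) = Bochner_integral lebesgue f"
proof (rule Bochner_integral_eq)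
  have T: "(\<lambda>x. c + x) \<in> lebesgue \<rightarrow>\<^sub>M lebesgue" "distr lebesgue lebesgue (\<lambda>x. c + x) = lebesgue"
    using distr_lebesgue_isometry[of 1 c] by simp_all
  have "range ((+) c) = UNIV" by (rule surj_plus)
  then have "has_Bochner_integral lebesgue (\<lambda>x. f (c + x)) (Bochner_integral lebesgue f)"
    using has_Bochner_integral_measure_preserving[OF
        has_Bochner_integral_Bochner_integral[OF assms] T] by (simp only: space_completion space_lborel space_borel)
  then show "has_Bochner_integral lebesgue (\<lambda>x. f (x + c)) (Bochner_integral lebesgue f)"
    by (simp only: add.commute[of _ c])
qed

section \<open>Uniform boundedness and strongly continuous families\<close>

text \<open>
  By Baire's theorem one of the closed sets \<open>E n\<close> of vectors on which the family is bounded by \<open>n\<close>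
  contains a ball around some \<open>a\<close>. Every small vector is a difference of a point of that ball and \<open>a\<close>,
  which bounds the family on a neighbourhood of zero.
\<close>

lemma Banach_Steinhaus:
  fixes A :: "'i \<Rightarrow> 'x::banach \<Rightarrow>\<^sub>L 'y::real_normed_vector"
  assumes bdd: "\<And>x. bounded ((\<lambda>i. blinfun_apply (A i) x) ` I)"
  shows "bounded (A ` I)"
proof -
  define E where "E n = {x. \<forall>i\<in>I. norm (blinfun_apply (A i) x) \<le> real n}" for n
  have cl: "closed (E n)" for n
  proof -
    have "E n = (\<Inter>i\<in>I. {x. norm (blinfun_apply (A i) x) \<le> real n})"
      by (auto simp: E_def)
    also have "closed \<dots>"
      by (intro closed_INT ballI closed_Collect_le continuous_intros)
    finally show ?thesis .
  qed
  have UN: "(\<Union>n. E n) = UNIV"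
  proof (intro equalityI subsetI UNIV_I)
    fix x
    obtain B where "\<And>i. i \<in> I \<Longrightarrow> norm (blinfun_apply (A i) x) \<le> B"
      using bdd[of x] by (auto simp: bounded_iff)
    moreover obtain n where "B \<le> real n" using real_arch_simple by blast
    ultimately show "x \<in> (\<Union>n. E n)" unfolding E_def UN_iff mem_Collect_eq by (meson UNIV_I order_trans)
  qed
  have "\<exists>n. interior (E n) \<noteq> {}"
  proof (rule ccontr)
    assume "\<not> ?thesis"
    then have "Met_TC.mtopology interior_of \<Union>(range E) = {}"
      by (intro Met_TC.metric_Baire_category_alt) (auto simp: cl complete_UNIV)
    then show False by (simp add: UN)
  qed
  then obtain n a where "a \<in> interior (E n)" by blast
  then obtain r where r: "0 < r" "cball a r \<subseteq> E n"
    by (auto simp: mem_interior_cball)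
  have "norm (A i) \<le> 2 * real n / r" if i: "i \<in> I" for i
  proof (rule norm_blinfun_bound)
    show "0 \<le> 2 * real n / r" using r by simp
    fix x
    show "norm (blinfun_apply (A i) x) \<le> 2 * real n / r * norm x"
    proof (cases "x = 0")
      case False
      let ?y = "(r / norm x) *\<^sub>R x"
      have "a + ?y \<in> E n" "a \<in> E n"
        using r False by (auto simp: dist_norm intro!: subsetD[OF r(2)])
      then have "norm (blinfun_apply (A i) (a + ?y)) \<le> real n" "norm (blinfun_apply (A i) a) \<le> real n"
        using i by (auto simp: E_def)
      moreover have "norm (blinfun_apply (A i) ?y) = norm (blinfun_apply (A i) (a + ?y) - blinfun_apply (A i) a)"
        by (simp add: blinfun.add_right)
      ultimately have "norm (blinfun_apply (A i) ?y) \<le> 2 * real n"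
        using norm_triangle_ineq4[of "blinfun_apply (A i) (a + ?y)" "blinfun_apply (A i) a"] by linarith
      moreover have "norm (blinfun_apply (A i) ?y) = r / norm x * norm (blinfun_apply (A i) x)"
        using r by (simp add: blinfun.scaleR_right)
      ultimately show ?thesis using r False by (simp add: field_simps)
    qed simp
  qed
  then show ?thesis by (auto simp: bounded_iff)
qed

lemma strongly_continuous_bounded_on_compact:
  fixes A :: "'a::topological_space \<Rightarrow> 'x::banach \<Rightarrow>\<^sub>L 'y::real_normed_vector"
  assumes "\<And>x. continuous_on UNIV (\<lambda>z. blinfun_apply (A z) x)" and "compact C"
  shows "bounded (A ` C)"
proof (rule Banach_Steinhaus)
  fix x
  show "bounded ((\<lambda>i. blinfun_apply (A i) x) ` C)"
    by (intro compact_imp_bounded compact_continuous_image assms(2) continuous_on_subset[OF assms(1)]) auto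
qed

text \<open>
  In the decomposition \<open>A z (u z) = A z (u z - u z0) + A z (u z0)\<close> the second term converges by strong
  continuity. The first tends to zero because the uniform boundedness principle bounds the operator
  norms near \<open>z0\<close>.
\<close>

lemma strongly_continuous_apply:
  fixes A :: "'a::heine_borel \<Rightarrow> 'x::banach \<Rightarrow>\<^sub>L 'y::real_normed_vector"
  assumes A: "\<And>x. continuous_on UNIV (\<lambda>z. blinfun_apply (A z) x)" and u: "continuous_on UNIV u"
  shows "continuous_on UNIV (\<lambda>z. blinfun_apply (A z) (u z))"
  unfolding continuous_on_def
proof
  fix z0
  obtain B where B: "\<And>z. z \<in> cball z0 1 \<Longrightarrow> norm (A z) \<le> B"
    using strongly_continuous_bounded_on_compact[OF A compact_cball[of z0 1]]
    unfolding bounded_iff by (metis imageI)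
  have uz: "(u \<longlongrightarrow> u z0) (at z0)" and Az: "((\<lambda>z. blinfun_apply (A z) (u z0)) \<longlongrightarrow> blinfun_apply (A z0) (u z0)) (at z0)"
    using u A[of "u z0"] by (auto simp: continuous_on_def)
  have "((\<lambda>z. blinfun_apply (A z) (u z - u z0)) \<longlongrightarrow> 0) (at z0)"
  proof (rule Lim_null_comparison)
    show "\<forall>\<^sub>F z in at z0. norm (blinfun_apply (A z) (u z - u z0)) \<le> B * norm (u z - u z0)"
    proof (rule eventually_at_ball'[OF zero_less_one, THEN eventually_mono])
      fix z assume "z \<in> ball z0 1 \<and> z \<noteq> z0 \<and> z \<in> UNIV"
      then have "norm (A z) \<le> B" by (intro B) auto
      then show "norm (blinfun_apply (A z) (u z - u z0)) \<le> B * norm (u z - u z0)"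
        by (intro order_trans[OF norm_blinfun] mult_right_mono) auto
    qed
    have "((\<lambda>z. B * norm (u z - u z0)) \<longlongrightarrow> B * norm (u z0 - u z0)) (at z0)"
      by (intro tendsto_intros uz)
    then show "((\<lambda>z. B * norm (u z - u z0)) \<longlongrightarrow> 0) (at z0)" by simp
  qed
  from tendsto_add[OF this Az]
  show "((\<lambda>z. blinfun_apply (A z) (u z)) \<longlongrightarrow> blinfun_apply (A z0) (u z0)) (at z0 within UNIV)"
    by (simp add: blinfun.diff_right)
qed

section \<open>Convergence on compact sets\<close>

definition compactly_convergent ::
    "(nat \<Rightarrow> 'a::topological_space \<Rightarrow> 'b::metric_space) \<Rightarrow> ('a \<Rightarrow> 'b) \<Rightarrow> bool" where
  "compactly_convergent F f \<longleftrightarrow> (\<forall>C. compact C \<longrightarrow> uniform_limit C F f sequentially)"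

lemma compactly_convergent_pointwise:
  assumes "compactly_convergent F f"
  shows "(\<lambda>l. F l x) \<longlonglongrightarrow> f x"
  using assms[unfolded compactly_convergent_def, rule_format, of "{x}"] by simp

lemma compactly_convergent_subseq:
  assumes "compactly_convergent F f" "strict_mono r"
  shows "compactly_convergent (\<lambda>l. F (r l)) f"
  using assms filterlim_compose[OF _ filterlim_subseq[OF assms(2)]]
  unfolding compactly_convergent_def by blast

lemma compactly_convergent_offset:
  fixes F :: "nat \<Rightarrow> 'a::topological_space \<Rightarrow> 'b::metric_space"
  assumes "compactly_convergent (\<lambda>l. F (k + l)) f"
  shows "compactly_convergent F f"
  unfolding compactly_convergent_def
proof (intro allI impI uniform_limitI)
  fix C :: "'a set" and e :: real assume "compact C" "0 < e"
  then have "\<forall>\<^sub>F l in sequentially. \<forall>x\<in>C. dist (F (l + k) x) (f x) < e"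
    using assms by (auto simp: compactly_convergent_def add.commute dest: uniform_limitD)
  then show "\<forall>\<^sub>F l in sequentially. \<forall>x\<in>C. dist (F l x) (f x) < e"
    by (rule eventually_sequentially_seg[THEN iffD1])
qed

lemma compactly_convergent_compose:
  assumes "compactly_convergent F f" "continuous_on UNIV g"
  shows "compactly_convergent (\<lambda>l x. F l (g x)) (\<lambda>x. f (g x))"
  unfolding compactly_convergent_def
proof (intro allI impI)
  fix C :: "'c set" assume "compact C"
  then have "compact (g ` C)"
    by (intro compact_continuous_image continuous_on_subset[OF assms(2)]) auto
  then have "uniform_limit (g ` C) F f sequentially"
    using assms(1) by (simp add: compactly_convergent_def)
  then show "uniform_limit C (\<lambda>l x. F l (g x)) (\<lambda>x. f (g x)) sequentially"
    by (rule uniform_limit_compose') auto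
qed

lemma compactly_convergent_continuous:
  fixes f :: "'a::heine_borel \<Rightarrow> 'b::metric_space"
  assumes F: "compactly_convergent F f" and cont: "\<And>l. continuous_on UNIV (F l)"
  shows "continuous_on UNIV f"
proof -
  have "continuous_on (ball x 1) f" for x
  proof -
    have "uniform_limit (cball x 1) F f sequentially"
      using F compact_cball by (auto simp: compactly_convergent_def)
    then have "continuous_on (cball x 1) f"
      by (intro uniform_limit_theorem[OF always_eventually])
        (auto intro: continuous_on_subset[OF cont])
    then show ?thesis by (rule continuous_on_subset) auto
  qed
  then have "continuous_on (\<Union>x. ball x 1) f"
    by (intro continuous_on_open_UN) auto
  moreover have "(\<Union>x::'a. ball x 1) = UNIV" by (auto intro!: exI)
  ultimately show ?thesis by simp
qed

text \<open>
  A product of uniformly convergent families converges uniformly when the limits are bounded, and on a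
  compact set both limits are: \<open>u\<close> by continuity, \<open>A\<close> by the uniform boundedness principle.
\<close>

lemma compactly_convergent_apply:
  fixes A :: "'a::topological_space \<Rightarrow> 'x::banach \<Rightarrow>\<^sub>L 'y::real_normed_vector"
  assumes A: "compactly_convergent As A" and u: "compactly_convergent us u"
    and contA: "\<And>x. continuous_on UNIV (\<lambda>z. blinfun_apply (A z) x)"
    and contu: "continuous_on UNIV u"
  shows "compactly_convergent (\<lambda>l z. blinfun_apply (As l z) (us l z)) (\<lambda>z. blinfun_apply (A z) (u z))"
  unfolding compactly_convergent_def
proof (intro allI impI)
  fix C :: "'a set" assume C: "compact C"
  have "bounded (u ` C)"
    by (intro compact_imp_bounded compact_continuous_image C continuous_on_subset[OF contu]) auto
  then show "uniform_limit C (\<lambda>l z. blinfun_apply (As l z) (us l z)) (\<lambda>z. blinfun_apply (A z) (u z)) sequentially"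
    using A u C strongly_continuous_bounded_on_compact[OF contA C]
    by (intro bounded_bilinear.bounded_uniform_limit[OF bounded_bilinear_blinfun_apply])
      (auto simp: compactly_convergent_def)
qed

text \<open>
  An \<open>e/3\<close> argument. A single index \<open>n\<close> must serve the approximants and their limit, uniformly in
  \<open>l\<close>.
\<close>

lemma compactly_convergent_uniform_approx:
  fixes F :: "'i \<Rightarrow> nat \<Rightarrow> 'a::topological_space \<Rightarrow> 'b::metric_space"
  assumes conv: "\<And>n. compactly_convergent (F n) (f n)"
    and approx: "\<And>e. 0 < e \<Longrightarrow> \<exists>n. (\<forall>l x. dist (F n l x) (G l x) < e) \<and> (\<forall>x. dist (f n x) (g x) < e)"
  shows "compactly_convergent G g"
  unfolding compactly_convergent_def
proof (intro allI impI uniform_limitI)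
  fix C :: "'a set" and e :: real assume C: "compact C" and e: "0 < e"
  obtain n where n: "\<And>l x. dist (F n l x) (G l x) < e / 3" "\<And>x. dist (f n x) (g x) < e / 3"
    using approx[of "e / 3"] e by auto
  have "\<forall>\<^sub>F l in sequentially. \<forall>x\<in>C. dist (F n l x) (f n x) < e / 3"
    using conv[of n] C e by (intro uniform_limitD) (simp_all add: compactly_convergent_def)
  then show "\<forall>\<^sub>F l in sequentially. \<forall>x\<in>C. dist (G l x) (g x) < e"
  proof (eventually_elim, intro ballI)
    fix l x assume "\<forall>x\<in>C. dist (F n l x) (f n x) < e / 3" "x \<in> C"
    then have "dist (F n l x) (f n x) < e / 3" by blast
    with n(1)[of l x] n(2)[of x] show "dist (G l x) (g x) < e"
      using dist_triangle[of "G l x" "g x" "F n l x"] dist_triangle[of "F n l x" "g x" "f n x"]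
      by (simp add: dist_commute)
  qed
qed

section \<open>Compactly almost automorphic functions\<close>

text \<open>
  The convergence back and forth along one fixed sequence. Isolating it turns the choice of subsequences
  into bookkeeping: the relation passes to subsequences, so finitely or countably many functions can be
  treated along a common one.
\<close>

definition AA_along ::
    "(nat \<Rightarrow> 'a::real_normed_vector) \<Rightarrow> ('a \<Rightarrow> 'b::metric_space) \<Rightarrow> ('a \<Rightarrow> 'b) \<Rightarrow> bool" where
  "AA_along b f g \<longleftrightarrow> compactly_convergent (\<lambda>l t. f (t + b l)) g \<and> compactly_convergent (\<lambda>l t. g (t - b l)) f"

lemma compactly_AA_iff:
  "f \<in> compactly_AA R \<longleftrightarrow> continuous_on UNIV f \<and>
    (\<forall>b\<in>R. \<exists>r g. strict_mono r \<and> AA_along (b \<circ> r) f g)"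
  by (simp add: compactly_AA_def AA_along_def compactly_convergent_def all_conj_distrib imp_conjR)

lemma compactly_bi_AA_iff:
  "compactly_bi_AA R K \<longleftrightarrow>
    (\<forall>b\<in>R. \<exists>r L. strict_mono r \<and> AA_along (\<lambda>l. (b (r l), b (r l))) (\<lambda>(t, s). K t s) (\<lambda>(t, s). L t s))"
  by (simp add: compactly_bi_AA_def AA_along_def compactly_convergent_def all_conj_distrib imp_conjR
      case_prod_beta')

lemma AA_along_subseq:
  "AA_along b f g \<Longrightarrow> strict_mono r \<Longrightarrow> AA_along (b \<circ> r) f g"
  by (auto simp: AA_along_def dest: compactly_convergent_subseq)

lemma AA_along_continuous:
  fixes f :: "'a::{real_normed_vector,heine_borel} \<Rightarrow> 'b::metric_space"
  assumes "AA_along b f g" "continuous_on UNIV f"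
  shows "continuous_on UNIV g"
proof (rule compactly_convergent_continuous)
  show "compactly_convergent (\<lambda>l t. f (t + b l)) g" using assms(1) by (simp add: AA_along_def)
  show "continuous_on UNIV (\<lambda>t. f (t + b l))" for l
    by (intro continuous_on_compose2[OF assms(2)] continuous_intros) auto
qed

lemma AA_along_pointwise:
  assumes "AA_along b f g"
  shows "(\<lambda>l. f (t + b l)) \<longlonglongrightarrow> g t" 
  using assms compactly_convergent_pointwise[of "\<lambda>l t. f (t + b l)"] by (simp add: AA_along_def)

lemma AA_along_offset:
  assumes "AA_along (\<lambda>l. b (k + l)) f g"
  shows "AA_along b f g"
  using assms by (auto simp: AA_along_def dest: compactly_convergent_offset)

text \<open>
  Countably many functions admit a common subsequence by the diagonal procedure. The diagonal sequence
  is a subsequence of the \<open>n\<close>th choice only from index \<open>n + 1\<close> on, which a shift of the index repairs.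
\<close>

lemma compactly_AA_diagonal:
  fixes f :: "nat \<Rightarrow> 'a::euclidean_space \<Rightarrow> 'b::real_normed_vector"
  assumes R: "\<And>b r. b \<in> R \<Longrightarrow> strict_mono r \<Longrightarrow> b \<circ> r \<in> R"
    and f: "\<And>n. f n \<in> compactly_AA R" and b: "b \<in> R"
  shows "\<exists>r g. strict_mono r \<and> (\<forall>n. AA_along (b \<circ> r) (f n) (g n))"
proof -
  interpret subseqs "\<lambda>n s. \<exists>g. AA_along (b \<circ> s) (f n) g"
  proof
    fix n and s :: "nat \<Rightarrow> nat" assume "strict_mono s"
    then have "b \<circ> s \<in> R" by (rule R[OF b])
    then show "\<exists>r'. strict_mono r' \<and> (\<exists>g. AA_along (b \<circ> (s \<circ> r')) (f n) g)"
      using f[of n] unfolding compactly_AA_iff by (metis comp_assoc)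
  qed
  have "\<exists>g. AA_along (b \<circ> (diagseq \<circ> (+) (Suc n))) (f n) g" for n
    by (rule diagseq_holds) (metis AA_along_subseq comp_assoc)
  then have "\<exists>g. AA_along (b \<circ> diagseq) (f n) g" for n
    using AA_along_offset[of "b \<circ> diagseq" "Suc n"] by (simp add: comp_def) blast
  then show ?thesis using subseq_diagseq by metis
qed

lemma subspace_compactly_AA_BC:
  assumes R: "\<And>b r. b \<in> R \<Longrightarrow> strict_mono r \<Longrightarrow> b \<circ> r \<in> R"
  shows "subspace (compactly_AA_BC R :: ('a::euclidean_space \<Rightarrow>\<^sub>C 'b::real_normed_vector) set)"
proof (rule subspaceI)
  have "\<exists>r g. strict_mono r \<and> AA_along (b \<circ> r) (\<lambda>t::'a. 0::'b) g" for b :: "nat \<Rightarrow> 'a"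
    by (intro exI[of _ id] exI[of _ "\<lambda>t. 0"])
      (auto simp: AA_along_def compactly_convergent_def strict_mono_def intro: uniform_limit_const)
  then show "(0 :: 'a \<Rightarrow>\<^sub>C 'b) \<in> compactly_AA_BC R"
    by (auto simp: compactly_AA_BC_def compactly_AA_iff zero_bcontfun.rep_eq)
next
  fix u v :: "'a \<Rightarrow>\<^sub>C 'b"
  assume u: "u \<in> compactly_AA_BC R" and v: "v \<in> compactly_AA_BC R"
  have "\<exists>r g. strict_mono r \<and> AA_along (b \<circ> r) (apply_bcontfun (u + v)) g" if b: "b \<in> R" for b
  proof -
    obtain r g where r: "strict_mono r" and g: "AA_along (b \<circ> r) (apply_bcontfun u) g"
      using u b by (auto simp: compactly_AA_BC_def compactly_AA_iff)
    obtain r' h where r': "strict_mono r'" and h: "AA_along (b \<circ> r \<circ> r') (apply_bcontfun v) h"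
      using v R[OF b r] by (auto simp: compactly_AA_BC_def compactly_AA_iff)
    have "AA_along (b \<circ> r \<circ> r') (apply_bcontfun (u + v)) (\<lambda>t. g t + h t)"
      using AA_along_subseq[OF g r'] h
      by (auto simp: AA_along_def compactly_convergent_def plus_bcontfun.rep_eq intro!: uniform_limit_add)
    then show ?thesis
      using strict_mono_o[OF r r'] by (auto simp: comp_assoc)
  qed
  then show "u + v \<in> compactly_AA_BC R"
    by (simp add: compactly_AA_BC_def compactly_AA_iff)
next
  fix c and u :: "'a \<Rightarrow>\<^sub>C 'b"
  assume u: "u \<in> compactly_AA_BC R"
  have "AA_along b (apply_bcontfun (c *\<^sub>R u)) (\<lambda>t. c *\<^sub>R g t)" if "AA_along b (apply_bcontfun u) g" for b g
    using that
    by (auto simp: AA_along_def compactly_convergent_def scaleR_bcontfun.rep_eq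
        intro!: bounded_linear.uniform_limit[OF bounded_linear_scaleR_right])
  then show "c *\<^sub>R u \<in> compactly_AA_BC R"
    using u unfolding compactly_AA_BC_def compactly_AA_iff by fastforce
qed

text \<open>
  It suffices that the class is closed under uniform limits. Along a common subsequence for all
  approximants \<open>u n\<close>, their limit functions \<open>g n\<close> are at uniform distance at most \<open>dist (u m) (u n)\<close>
  from each other; so they converge uniformly, and the uniform limit is the companion of \<open>v\<close>.
\<close>

lemma complete_compactly_AA_BC:
  assumes R: "\<And>b r. b \<in> R \<Longrightarrow> strict_mono r \<Longrightarrow> b \<circ> r \<in> R"
  shows "complete (compactly_AA_BC R :: ('a::euclidean_space \<Rightarrow>\<^sub>C 'b::banach) set)"
  unfolding complete_eq_closed closed_sequential_limits
proof (intro allI impI, elim conjE)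
  fix u :: "nat \<Rightarrow> 'a \<Rightarrow>\<^sub>C 'b" and v
  assume u: "\<forall>n. u n \<in> compactly_AA_BC R" and lim: "u \<longlonglongrightarrow> v"
  have "\<exists>r g. strict_mono r \<and> AA_along (b \<circ> r) (apply_bcontfun v) g" if b: "b \<in> R" for b
  proof -
    obtain r g where r: "strict_mono r" and g: "\<And>n. AA_along (b \<circ> r) (apply_bcontfun (u n)) (g n)"
      using compactly_AA_diagonal[of R "\<lambda>n. apply_bcontfun (u n)" b, OF R] u b
      by (auto simp: compactly_AA_BC_def)
    have gd: "dist (g m t) (g n t) \<le> dist (u m) (u n)" for m n t
    proof (rule tendsto_upperbound)
      show "(\<lambda>l. dist (apply_bcontfun (u m) (t + (b \<circ> r) l)) (apply_bcontfun (u n) (t + (b \<circ> r) l)))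
          \<longlonglongrightarrow> dist (g m t) (g n t)"
        by (intro tendsto_dist AA_along_pointwise g)
    qed (auto intro!: always_eventually dist_bounded)
    have "Cauchy u" using lim by (rule LIMSEQ_imp_Cauchy)
    have "\<exists>h. \<forall>e>0. \<exists>N. \<forall>n x. N \<le> n \<and> True \<longrightarrow> dist (g n x) (h x) < e"
      unfolding uniformly_convergent_eq_cauchy
      using \<open>Cauchy u\<close> gd unfolding Cauchy_def by (meson le_less_trans)
    then obtain h where h: "\<And>e. 0 < e \<Longrightarrow> \<exists>N. \<forall>n\<ge>N. \<forall>x. dist (g n x) (h x) < e"
      by metis
    have approx: "\<exists>n. (\<forall>x. dist (apply_bcontfun (u n) x) (apply_bcontfun v x) < e) \<and> (\<forall>x. dist (g n x) (h x) < e)"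
      if e: "0 < e" for e
    proof -
      obtain N where N: "\<And>n. n \<ge> N \<Longrightarrow> \<forall>x. dist (g n x) (h x) < e" using h[OF e] by blast
      obtain M where M: "\<And>n. n \<ge> M \<Longrightarrow> dist (u n) v < e" using lim e by (auto simp: lim_sequentially)
      show ?thesis
        using N[of "max M N"] M[of "max M N"] by (auto intro!: exI[of _ "max M N"] dist_fun_lt_imp_dist_val_lt)
    qed
    have "AA_along (b \<circ> r) (apply_bcontfun v) h"
      unfolding AA_along_def
    proof
      show "compactly_convergent (\<lambda>l t. apply_bcontfun v (t + (b \<circ> r) l)) h"
      proof (rule compactly_convergent_uniform_approx[where F = "\<lambda>n l t. apply_bcontfun (u n) (t + (b \<circ> r) l)" and f = "g"])
        show "compactly_convergent (\<lambda>l t. apply_bcontfun (u n) (t + (b \<circ> r) l)) (g n)" for n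
          using g by (simp add: AA_along_def)
      qed (use approx in blast)
      show "compactly_convergent (\<lambda>l t. h (t - (b \<circ> r) l)) (apply_bcontfun v)"
      proof (rule compactly_convergent_uniform_approx[where F = "\<lambda>n l t. g n (t - (b \<circ> r) l)" and f = "\<lambda>n. apply_bcontfun (u n)"])
        show "compactly_convergent (\<lambda>l t. g n (t - (b \<circ> r) l)) (apply_bcontfun (u n))" for n
          using g by (simp add: AA_along_def)
      qed (use approx in blast)
    qed
    with r show ?thesis by blast
  qed
  then show "v \<in> compactly_AA_BC R"
    by (simp add: compactly_AA_BC_def compactly_AA_iff)
qed

section \<open>Parameter integrals with a translation-invariant bound\<close>

lemma compactly_convergent_translate:
  fixes f :: "'a::euclidean_space \<Rightarrow> 'b::metric_space"
  assumes f: "continuous_on UNIV f" and b: "b \<longlonglongrightarrow> 0"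
  shows "compactly_convergent (\<lambda>l z. f (z + b l)) f"
  unfolding compactly_convergent_def
proof (intro allI impI)
  fix C :: "'a set" assume C: "compact C"
  let ?B = "{x + y | x y. x \<in> C \<and> y \<in> cball 0 1}"
  have B: "compact ?B" by (intro compact_sums C compact_cball)
  have ev: "\<forall>\<^sub>F l in sequentially. norm (b l) < e" if "0 < e" for e
    using tendstoD[OF b that] by simp
  show "uniform_limit C (\<lambda>l z. f (z + b l)) f sequentially"
  proof (rule uniform_limit_compose_uniformly_continuous_on[where g = "\<lambda>l z. z + b l" and g' = "\<lambda>z. z" and B = ?B])
    show "uniform_limit C (\<lambda>l z. z + b l) (\<lambda>z. z) sequentially"
      using ev by (intro uniform_limitI) (auto simp: dist_norm)
    show "uniformly_continuous_on ?B f"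
      by (intro compact_uniformly_continuous B continuous_on_subset[OF f]) auto
    show "\<forall>\<^sub>F l in sequentially. \<forall>z\<in>C. z + b l \<in> ?B"
      using ev[OF zero_less_one] by eventually_elim (auto intro!: exI)
    show "closed ?B" using B by (rule compact_imp_closed)
  qed
qed

lemma integrable_reflect_translate:
  fixes h :: "'a::euclidean_space \<Rightarrow> real"
  assumes "integrable lebesgue h"
  shows "integrable lebesgue (\<lambda>s. h (t - s))"
proof -
  have "(\<lambda>x. t - x) \<in> lebesgue \<rightarrow>\<^sub>M lebesgue" "distr lebesgue lebesgue (\<lambda>x. t - x) = lebesgue"
    using distr_lebesgue_isometry[of "-1" t] by simp_all
  then show ?thesis
    using assms integrable_distr_eq[of "\<lambda>x. t - x" lebesgue lebesgue h] by auto
qed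

lemma Bochner_integral_norm_le:
  fixes g :: "'a::euclidean_space \<Rightarrow> 'b::banach"
  assumes g: "continuous_on UNIV g" and h: "integrable lebesgue h"
    and gh: "\<And>x. norm (g x) \<le> h x"
  shows "norm (Bochner_integral lebesgue g) \<le> integral\<^sup>L lebesgue h"
proof -
  have nn: "0 \<le> h x" for x using gh[of x] norm_ge_zero order_trans by blast
  have "has_Bochner_integral lebesgue (\<lambda>x::'a. 0 :: 'b) 0"
  proof
    have *: "Bochner_Integration.simple_bochner_integrable lebesgue (\<lambda>x::'a. 0 :: 'b)"
      by (rule simple_bochner_integrable.intros) auto
    then show "Bochner_Integration.simple_bochner_integrable lebesgue (\<lambda>x::'a. 0 :: 'b)" .
  qed (auto simp: simple_bochner_integral_def)
  from has_Bochner_integral_dist_le[OF has_Bochner_integral_Bochner_integral[OF Bochner_integrable_continuous[OF g h gh]] this]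
  have "ennreal (norm (Bochner_integral lebesgue g)) \<le> (\<integral>\<^sup>+x. norm (g x) \<partial>lebesgue)"
    using g by (simp add: borel_measurable_lebesgue_continuous continuous_on_norm)
  also have "\<dots> \<le> (\<integral>\<^sup>+x. h x \<partial>lebesgue)"
    by (intro nn_integral_mono ennreal_leI gh)
  also have "\<dots> = ennreal (integral\<^sup>L lebesgue h)"
    using h nn by (intro nn_integral_eq_integral) auto
  finally show ?thesis using nn by (simp add: integral_nonneg)
qed

text \<open>
  Dominated convergence, uniform in the parameter. After the substitution \<open>s = t - x\<close> the integrands are
  bounded by \<open>h x\<close> for every \<open>t\<close>, so one ball in \<open>x\<close> carries all but a small part of the mass for all
  \<open>t\<close> at once. For \<open>t \<in> C\<close> and \<open>x\<close> in that ball the pairs \<open>(t, t - x)\<close> fill a compact set, on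
  which \<open>F l\<close> converges uniformly.
\<close>

lemma compactly_convergent_Bochner_integral:
  fixes F :: "nat \<Rightarrow> 'a::euclidean_space \<times> 'a \<Rightarrow> 'b::banach"
  assumes conv: "compactly_convergent F G"
    and contF: "\<And>l. continuous_on UNIV (F l)"
    and h: "integrable lebesgue h" and Fh: "\<And>l t s. norm (F l (t, s)) \<le> h (t - s)"
  shows "compactly_convergent (\<lambda>l t. Bochner_integral lebesgue (\<lambda>s. F l (t, s)))
    (\<lambda>t. Bochner_integral lebesgue (\<lambda>s. G (t, s)))"
  unfolding compactly_convergent_def
proof (intro allI impI uniform_limitI)
  fix C :: "'a set" and e :: real
  assume C: "compact C" and e: "0 < e"
  have contG: "continuous_on UNIV G"
    by (rule compactly_convergent_continuous[OF conv contF])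
  have Gh: "norm (G (t, s)) \<le> h (t - s)" for t s
    using Fh by (intro tendsto_upperbound[OF tendsto_norm[OF compactly_convergent_pointwise[OF conv]]]) auto
  have nn: "0 \<le> h x" for x using order_trans[OF norm_ge_zero Gh[of x 0]] by simp
  have hm[measurable]: "h \<in> borel_measurable lebesgue" using h by auto
  have "\<forall>\<^sub>F n in sequentially. (\<integral>\<^sup>+x. ennreal (h x * indicator (- cball 0 (real n)) x) \<partial>lebesgue) < ennreal (e / 4)"
    using e by (intro order_tendstoD(2)[OF nn_integral_tail_tendsto_0[OF h nn]]) auto
  then obtain n where n: "(\<integral>\<^sup>+x. ennreal (h x * indicator (- cball 0 (real n)) x) \<partial>lebesgue) < ennreal (e / 4)"
    by (auto simp: eventually_sequentially)
  let ?B = "cball (0::'a) (real n)"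
  let ?v = "measure lebesgue ?B"
  have B[measurable]: "?B \<in> sets lebesgue" by (simp add: fmeasurableD)
  have em: "emeasure lebesgue ?B = ennreal ?v"
    by (simp add: emeasure_eq_measure2 fmeasurableD2)
  \<comment> \<open>Contributions to the error: at most \<open>e/4\<close> from the ball, and twice the tail mass, hence less than
    \<open>e/2\<close>, from its complement.\<close>
  define d where "d = e / (4 * (1 + ?v))"
  have d: "0 < d" using e by (simp add: d_def add_pos_nonneg)
  have "d * (1 + ?v) = e / 4"
    using measure_nonneg[of lebesgue ?B] by (simp add: d_def field_simps add_nonneg_eq_0_iff)
  then have dv: "d * ?v \<le> e / 4" using d by (simp add: algebra_simps)
  have "compact ((\<lambda>(t, x). (t, t - x)) ` (C \<times> ?B))"
    unfolding case_prod_beta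
    by (intro compact_continuous_image compact_Times C compact_cball continuous_intros)
  then have "\<forall>\<^sub>F l in sequentially. \<forall>z\<in>(\<lambda>(t, x). (t, t - x)) ` (C \<times> ?B). dist (F l z) (G z) < d"
    using conv d by (intro uniform_limitD) (simp_all only: compactly_convergent_def)
  then show "\<forall>\<^sub>F l in sequentially. \<forall>t\<in>C. dist (Bochner_integral lebesgue (\<lambda>s. F l (t, s)))
      (Bochner_integral lebesgue (\<lambda>s. G (t, s))) < e"
  proof (eventually_elim, intro ballI)
    fix l t
    assume close: "\<forall>z\<in>(\<lambda>(t, x). (t, t - x)) ` (C \<times> ?B). dist (F l z) (G z) < d" and t: "t \<in> C"
    have T: "(\<lambda>x. t - x) \<in> lebesgue \<rightarrow>\<^sub>M lebesgue" "distr lebesgue lebesgue (\<lambda>x. t - x) = lebesgue"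
      using distr_lebesgue_isometry[of "-1" t] by simp_all
    have cF: "continuous_on UNIV (\<lambda>s. F l (t, s))" and cG: "continuous_on UNIV (\<lambda>s. G (t, s))"
      by (intro continuous_on_compose2[OF contF] continuous_on_compose2[OF contG] continuous_intros; simp)+
    have norm_meas: "(\<lambda>s. norm (F l (t, s) - G (t, s))) \<in> borel_measurable lebesgue"
      by (intro borel_measurable_lebesgue_continuous continuous_intros cF cG)
    have "ennreal (dist (Bochner_integral lebesgue (\<lambda>s. F l (t, s))) (Bochner_integral lebesgue (\<lambda>s. G (t, s))))
      \<le> (\<integral>\<^sup>+s. norm (F l (t, s) - G (t, s)) \<partial>lebesgue)"
      unfolding dist_norm
      by (intro has_Bochner_integral_dist_le has_Bochner_integral_Bochner_integral norm_meas
          Bochner_integrable_continuous[OF cF integrable_reflect_translate[OF h] Fh]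
          Bochner_integrable_continuous[OF cG integrable_reflect_translate[OF h] Gh])
    also have "\<dots> = (\<integral>\<^sup>+s. norm (F l (t, s) - G (t, s)) \<partial>distr lebesgue lebesgue (\<lambda>x. t - x))"
      by (simp only: T(2))
    also have "\<dots> = (\<integral>\<^sup>+x. norm (F l (t, t - x) - G (t, t - x)) \<partial>lebesgue)"
      by (rule nn_integral_distr[OF T(1)]) (use norm_meas in simp)
    also have "\<dots> \<le> (\<integral>\<^sup>+x. ennreal d * indicator ?B x + 2 * ennreal (h x * indicator (- ?B) x) \<partial>lebesgue)"
    proof (rule nn_integral_mono)
      fix x
      show "ennreal (norm (F l (t, t - x) - G (t, t - x)))
        \<le> ennreal d * indicator ?B x + 2 * ennreal (h x * indicator (- ?B) x)"
      proof (cases "x \<in> ?B")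
        case True
        then have "dist (F l (t, t - x)) (G (t, t - x)) < d"
          using close t by force
        with True show ?thesis by (simp add: dist_norm ennreal_leI)
      next
        case False
        have "norm (F l (t, t - x) - G (t, t - x)) \<le> 2 * h x"
          using Fh[of l t "t - x"] Gh[of t "t - x"] norm_triangle_ineq4[of "F l (t, t - x)" "G (t, t - x)"]
          by simp
        then have "ennreal (norm (F l (t, t - x) - G (t, t - x))) \<le> ennreal (2 * h x)"
          by (rule ennreal_leI)
        with False show ?thesis by (simp add: ennreal_mult nn)
      qed
    qed
    also have "\<dots> = ennreal (d * ?v) + 2 * (\<integral>\<^sup>+x. ennreal (h x * indicator (- ?B) x) \<partial>lebesgue)"
      using d by (subst nn_integral_add) (auto simp: nn_integral_cmult nn_integral_cmult_indicator em ennreal_mult)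
    also have "\<dots> \<le> ennreal (e / 4) + 2 * ennreal (e / 4)"
      using n dv by (intro add_mono mult_left_mono ennreal_leI) auto
    also have "\<dots> = ennreal (e / 4 + 2 * (e / 4))"
    proof -
      have "ennreal (e / 4 + 2 * (e / 4)) = ennreal (e / 4) + ennreal (2 * (e / 4))"
        using e by (intro ennreal_plus) auto
      also have "ennreal (2 * (e / 4)) = 2 * ennreal (e / 4)"
        by (subst ennreal_mult') auto
      finally show ?thesis by simp
    qed
    also have "\<dots> < ennreal e" using e by (intro ennreal_lessI) auto
    finally show "dist (Bochner_integral lebesgue (\<lambda>s. F l (t, s))) (Bochner_integral lebesgue (\<lambda>s. G (t, s))) < e"
      using e by (simp add: ennreal_less_iff)
  qed
qed

text \<open>
  Shifting the parameter by \<open>c\<close> may be replaced by shifting both arguments of \<open>F\<close>, since the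
  integral does not see a translation of \<open>s\<close>. The dominating function depends on \<open>t - s\<close> only, so a
  diagonal shift leaves it unchanged.
\<close>

lemma compactly_convergent_integral_translates:
  fixes F :: "'a::euclidean_space \<times> 'a \<Rightarrow> 'b::banach"
  assumes conv: "compactly_convergent (\<lambda>l z. F (z + (c l, c l))) G"
    and contF: "continuous_on UNIV F"
    and h: "integrable lebesgue h" and Fh: "\<And>t s. norm (F (t, s)) \<le> h (t - s)"
  shows "compactly_convergent (\<lambda>l t. Bochner_integral lebesgue (\<lambda>s. F (t + c l, s)))
    (\<lambda>t. Bochner_integral lebesgue (\<lambda>s. G (t, s)))"
proof -
  have "Bochner_integral lebesgue (\<lambda>s. F (t + c l, s + c l)) = Bochner_integral lebesgue (\<lambda>s. F (t + c l, s))" for t l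
  proof (rule Bochner_integral_translation)
    have "continuous_on UNIV (\<lambda>s. F (t + c l, s))"
      by (intro continuous_on_compose2[OF contF] continuous_intros) auto
    then show "Bochner_integrable lebesgue (\<lambda>s. F (t + c l, s))"
      using integrable_reflect_translate[OF h] Fh by (rule Bochner_integrable_continuous)
  qed
  moreover have "compactly_convergent (\<lambda>l t. Bochner_integral lebesgue (\<lambda>s. F ((t, s) + (c l, c l))))
    (\<lambda>t. Bochner_integral lebesgue (\<lambda>s. G (t, s)))"
  proof (rule compactly_convergent_Bochner_integral[OF conv _ h])
    show "continuous_on UNIV (\<lambda>z. F (z + (c l, c l)))" for l
      by (intro continuous_on_compose2[OF contF] continuous_intros) auto
    show "norm (F ((t, s) + (c l, c l))) \<le> h (t - s)" for l t s
      using Fh[of "t + c l" "s + c l"] by simp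
  qed
  ultimately show ?thesis by simp
qed

text \<open>
  Continuity is the convergence of translates with the null sequence \<open>x l - t\<close> as shifts.
\<close>

lemma continuous_on_Bochner_integral:
  fixes F :: "'a::euclidean_space \<times> 'a \<Rightarrow> 'b::banach"
  assumes contF: "continuous_on UNIV F"
    and h: "integrable lebesgue h" and Fh: "\<And>t s. norm (F (t, s)) \<le> h (t - s)"
  shows "continuous_on UNIV (\<lambda>t. Bochner_integral lebesgue (\<lambda>s. F (t, s)))"
  unfolding continuous_on_sequentially
proof (intro allI ballI impI, elim conjE)
  fix x :: "nat \<Rightarrow> 'a" and t assume x: "x \<longlonglongrightarrow> t"
  let ?c = "\<lambda>l. x l - t"
  have "(\<lambda>l. (?c l, ?c l)) \<longlonglongrightarrow> (t - t, t - t)"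
    by (intro tendsto_intros x)
  then have "compactly_convergent (\<lambda>l z. F (z + (?c l, ?c l))) F"
    by (intro compactly_convergent_translate contF) (simp add: zero_prod_def)
  from compactly_convergent_pointwise[OF compactly_convergent_integral_translates[OF this contF h Fh], of t]
  show "((\<lambda>t. Bochner_integral lebesgue (\<lambda>s. F (t, s))) \<circ> x) \<longlonglongrightarrow> Bochner_integral lebesgue (\<lambda>s. F (t, s))"
    by (simp add: comp_def)
qed

text \<open>
  The limit kernel \<open>G\<close> inherits continuity and the bound from \<open>F\<close>; the hypotheses are therefore
  symmetric, and the two required convergences are the same statement with opposite shifts.
\<close>

lemma AA_along_Bochner_integral:
  fixes F G :: "'a::euclidean_space \<times> 'a \<Rightarrow> 'b::banach"
  assumes FG: "AA_along (\<lambda>l. (b l, b l)) F G" and contF: "continuous_on UNIV F"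
    and h: "integrable lebesgue h" and Fh: "\<And>t s. norm (F (t, s)) \<le> h (t - s)"
  shows "AA_along b (\<lambda>t. Bochner_integral lebesgue (\<lambda>s. F (t, s))) (\<lambda>t. Bochner_integral lebesgue (\<lambda>s. G (t, s)))"
proof -
  have contG: "continuous_on UNIV G" by (rule AA_along_continuous[OF FG contF])
  have Gh: "norm (G (t, s)) \<le> h (t - s)" for t s
  proof (rule tendsto_upperbound)
    show "(\<lambda>l. norm (F ((t, s) + (b l, b l)))) \<longlonglongrightarrow> norm (G (t, s))"
      by (intro tendsto_norm AA_along_pointwise FG)
    show "\<forall>\<^sub>F l in sequentially. norm (F ((t, s) + (b l, b l))) \<le> h (t - s)"
      using Fh[of "t + b l" "s + b l" for l] by (intro always_eventually) simp
  qed simp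
  have "compactly_convergent (\<lambda>l z. F (z + (b l, b l))) G"
    "compactly_convergent (\<lambda>l z. G (z + (- b l, - b l))) F"
    using FG by (simp_all add: AA_along_def flip: uminus_Pair)
  from compactly_convergent_integral_translates[OF this(1) contF h Fh]
    compactly_convergent_integral_translates[OF this(2) contG h Gh]
  show ?thesis by (simp add: AA_along_def)
qed

section \<open>The integral operator\<close>

lemma AA_along_compose_snd:
  assumes "AA_along b f g"
  shows "AA_along (\<lambda>l. (c l, b l)) (\<lambda>z. f (snd z)) (\<lambda>z. g (snd z))"
  using assms compactly_convergent_compose[where g = snd] continuous_on_snd[OF continuous_on_id]
  by (fastforce simp: AA_along_def)

text \<open>
  The limit operators are again strongly continuous, as compact limits of strongly continuous families,
  so the product rule for compact convergence applies in both directions.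
\<close>

lemma AA_along_apply:
  fixes A :: "'a::euclidean_space \<Rightarrow> 'x::banach \<Rightarrow>\<^sub>L 'y::real_normed_vector"
  assumes A: "AA_along b A A'" and u: "AA_along b u u'"
    and contA: "\<And>x. continuous_on UNIV (\<lambda>z. blinfun_apply (A z) x)"
    and contu: "continuous_on UNIV u"
  shows "AA_along b (\<lambda>z. blinfun_apply (A z) (u z)) (\<lambda>z. blinfun_apply (A' z) (u' z))"
proof -
  have contu': "continuous_on UNIV u'" by (rule AA_along_continuous[OF u contu])
  have contA': "continuous_on UNIV (\<lambda>z. blinfun_apply (A' z) x)" for x
  proof (rule compactly_convergent_continuous)
    have "compactly_convergent (\<lambda>l z. A (z + b l)) A'" using A by (simp add: AA_along_def)
    then show "compactly_convergent (\<lambda>l z. blinfun_apply (A (z + b l)) x) (\<lambda>z. blinfun_apply (A' z) x)"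
      unfolding compactly_convergent_def
      by (auto intro!: bounded_linear.uniform_limit[OF blinfun.bounded_linear_left])
    show "continuous_on UNIV (\<lambda>z. blinfun_apply (A (z + b l)) x)" for l
      by (intro continuous_on_compose2[OF contA] continuous_intros) auto
  qed
  show ?thesis
    using A u contA contu contA' contu' unfolding AA_along_def
    by (auto intro!: compactly_convergent_apply)
qed

theorem theorem5p4:
  fixes G :: "(real ^ 'm) set"
    and R :: "(nat \<Rightarrow> real ^ 'm) set"
    and K :: "real ^ 'm \<Rightarrow> real ^ 'm \<Rightarrow> ('x::banach \<Rightarrow>\<^sub>L 'y::banach)"
    and \<phi> :: "real ^ 'm \<Rightarrow> real"
  assumes "G \<noteq> {}"
    and "R \<noteq> {}"
    and "\<And>b. b \<in> R \<Longrightarrow> range b \<subseteq> G"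
    and "\<And>b r. b \<in> R \<Longrightarrow> strict_mono r \<Longrightarrow> b \<circ> r \<in> R"
    and "property_SC K"
    and "compactly_bi_AA R K"
    and "integrable lebesgue \<phi>"
    and "lambda_bounded (\<lambda>t s. \<phi> (t - s)) K"
  shows "subspace (compactly_AA_BC R :: ((real ^ 'm) \<Rightarrow>\<^sub>C 'x) set) \<and>
    complete (compactly_AA_BC R :: ((real ^ 'm) \<Rightarrow>\<^sub>C 'x) set) \<and>
    subspace (compactly_AA_BC R :: ((real ^ 'm) \<Rightarrow>\<^sub>C 'y) set) \<and>
    complete (compactly_AA_BC R :: ((real ^ 'm) \<Rightarrow>\<^sub>C 'y) set) \<and>
    (\<forall>u \<in> compactly_AA_BC R.
      (\<forall>t. Bochner_integrable lebesgue (\<lambda>\<eta>. blinfun_apply (K t \<eta>) (apply_bcontfun u \<eta>))) \<and>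
      (\<exists>v \<in> compactly_AA_BC R. apply_bcontfun v = Gamma_op K (apply_bcontfun u)))"
proof (intro conjI ballI allI)
  note R = assms(4)
  show "subspace (compactly_AA_BC R :: ((real ^ 'm) \<Rightarrow>\<^sub>C 'x) set)"
    "subspace (compactly_AA_BC R :: ((real ^ 'm) \<Rightarrow>\<^sub>C 'y) set)"
    by (rule subspace_compactly_AA_BC[OF R]; assumption)+
  show "complete (compactly_AA_BC R :: ((real ^ 'm) \<Rightarrow>\<^sub>C 'x) set)"
    "complete (compactly_AA_BC R :: ((real ^ 'm) \<Rightarrow>\<^sub>C 'y) set)"
    by (rule complete_compactly_AA_BC[OF R]; assumption)+
  fix u :: "(real ^ 'm) \<Rightarrow>\<^sub>C 'x" assume u: "u \<in> compactly_AA_BC R"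
  define F where "F z = blinfun_apply (case z of (t, s) \<Rightarrow> K t s) (apply_bcontfun u (snd z))" for z
  define h where "h x = \<phi> x * norm u" for x
  have contK: "continuous_on UNIV (\<lambda>z. blinfun_apply (case z of (t, s) \<Rightarrow> K t s) x)" for x
    using assms(5) by (simp add: property_SC_def case_prod_beta')
  have contu: "continuous_on UNIV (\<lambda>z. apply_bcontfun u (snd z))"
    by (intro continuous_on_compose2[OF continuous_on_apply_bcontfun] continuous_intros) auto
  have contF: "continuous_on UNIV F"
    unfolding F_def by (rule strongly_continuous_apply[OF contK contu])
  have h: "integrable lebesgue h" unfolding h_def using assms(7) by simp
  have Fh: "norm (F (t, s)) \<le> h (t - s)" for t s
  proof -
    have "norm (K (t + 0) (s + 0)) \<le> \<phi> (t - s)"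
      using assms(8) unfolding lambda_bounded_def by blast
    then have "norm (K t s) * norm (apply_bcontfun u s) \<le> \<phi> (t - s) * norm u"
      by (intro mult_mono norm_bounded) (auto intro: order_trans[OF norm_ge_zero])
    then show ?thesis
      unfolding F_def h_def by (auto intro: order_trans[OF norm_blinfun])
  qed
  have contFt: "continuous_on UNIV (\<lambda>s. F (t, s))" for t
    by (intro continuous_on_compose2[OF contF] continuous_intros) auto
  note hr = integrable_reflect_translate[OF h]
  show "Bochner_integrable lebesgue (\<lambda>\<eta>. blinfun_apply (K t \<eta>) (apply_bcontfun u \<eta>))" for t
    using Bochner_integrable_continuous[OF contFt hr Fh, of t] by (simp add: F_def)
  have \<Gamma>: "Gamma_op K (apply_bcontfun u) = (\<lambda>t. Bochner_integral lebesgue (\<lambda>s. F (t, s)))"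
    by (simp add: Gamma_op_def F_def fun_eq_iff)
  have cont\<Gamma>: "continuous_on UNIV (Gamma_op K (apply_bcontfun u))"
    unfolding \<Gamma> by (rule continuous_on_Bochner_integral[OF contF h Fh])
  have "norm (Gamma_op K (apply_bcontfun u) t) \<le> integral\<^sup>L lebesgue h" for t
  proof -
    have T: "(\<lambda>x. t - x) \<in> lebesgue \<rightarrow>\<^sub>M lebesgue" "distr lebesgue lebesgue (\<lambda>x. t - x) = lebesgue"
      using distr_lebesgue_isometry[of "-1" t] by simp_all
    have "integral\<^sup>L lebesgue (\<lambda>s. h (t - s)) = integral\<^sup>L (distr lebesgue lebesgue (\<lambda>x. t - x)) h"
      using h by (intro integral_distr[symmetric] T) auto
    then show ?thesis
      using Bochner_integral_norm_le[OF contFt hr Fh, of t] by (simp add: \<Gamma> T(2))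
  qed
  with cont\<Gamma> have bc: "Gamma_op K (apply_bcontfun u) \<in> bcontfun"
    by (rule bcontfun_normI)
  have "\<exists>r g. strict_mono r \<and> AA_along (b \<circ> r) (Gamma_op K (apply_bcontfun u)) g" if b: "b \<in> R" for b
  proof -
    \<comment> \<open>The subsequence for the kernel is chosen inside the one for \<open>u\<close>, which is possible because
      \<open>R\<close> contains \<open>b \<circ> r\<close>.\<close>
    obtain r w where r: "strict_mono r" and w: "AA_along (b \<circ> r) (apply_bcontfun u) w"
      using u b by (auto simp: compactly_AA_BC_def compactly_AA_iff)
    obtain r' L where r': "strict_mono r'"
      and L: "AA_along (\<lambda>l. ((b \<circ> r) (r' l), (b \<circ> r) (r' l))) (\<lambda>(t, s). K t s) (\<lambda>(t, s). L t s)"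
      using assms(6) R[OF b r] unfolding compactly_bi_AA_iff by blast
    have "AA_along (\<lambda>l. ((b \<circ> r) (r' l), (b \<circ> r) (r' l))) (\<lambda>z. apply_bcontfun u (snd z)) (\<lambda>z. w (snd z))"
      using AA_along_compose_snd[OF AA_along_subseq[OF w r']] by (simp add: comp_def)
    from AA_along_Bochner_integral[OF AA_along_apply[OF L this contK contu, folded F_def] contF h Fh]
    have "AA_along (b \<circ> (r \<circ> r')) (Gamma_op K (apply_bcontfun u))
        (\<lambda>t. Bochner_integral lebesgue (\<lambda>s. blinfun_apply (L t s) (w s)))"
      by (simp add: \<Gamma> comp_def)
    with strict_mono_o[OF r r'] show ?thesis by blast
  qed
  with cont\<Gamma> have "Gamma_op K (apply_bcontfun u) \<in> compactly_AA R"
    by (simp add: compactly_AA_iff)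
  then show "\<exists>v\<in>compactly_AA_BC R. apply_bcontfun v = Gamma_op K (apply_bcontfun u)"
    using Bcontfun_inverse[OF bc] by (intro bexI[of _ "Bcontfun (Gamma_op K (apply_bcontfun u))"])
      (simp_all add: compactly_AA_BC_def)
qed

end
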